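(* There exists a strictly stable, symmetric matrix $A \in \mathbb{R}^{6 \times 6}$ such that the function $S \mapsto \mathcal{E}_{\rm ave}(A, I_6(S), +\infty)$, defined on subsets $S$ of $\{1,\ldots,6\}$, is not supermodular.
   Context: A square real matrix is called strictly stable if all of its eigenvalues have negative real parts. $I_6$ is the $6 \times 6$ identity matrix, and for $S \subset \{1,\ldots,6\}$, $I_6(S) \in \mathbb{R}^{6 \times |S|}$ denotes the matrix composed of the columns of $I_6$ with indices in $S$. For a strictly stable $A \in \mathbb{R}^{n \times n}$ and $B \in \mathbb{R}^{n \times k}$, the (infinite-horizon) controllability Gramian is $W(A,B,+\infty) = \int_0^{+\infty} e^{At} B B' e^{A't}\, dt$, where $M'$ denotes the transpose of $M$ (if $k=0$ the Gramian is the zero matrix). The average control energy is $$\mathcal{E}_{\rm ave}(A,B,+\infty) = \frac{1}{n}\,\mathrm{tr}\left[ W(A,B,+\infty)^{-1} \right]$$ if $W(A,B,+\infty)$ is invertible, and $\mathcal{E}_{\rm ave}(A,B,+\infty) = +\infty$ otherwise. (It represents the expected minimal input energy $\int \|u(t)\|_2^2\,dt$ needed to steer $\dot{x} = Ax+Bu$ from the origin to a uniformly random point of the unit sphere.) A function $f : 2^{\{1,\ldots,m\}} \to \mathbb{R} \cup \{+\infty\}$ is called supermodular if $$f(S_1) - f(S_1 \cup \{a\}) \geq f(S_2) - f(S_2 \cup \{a\})$$ for all $S_1 \subset S_2 \subset \{1,\ldots,m\}$ and $a \in \{1,\ldots,m\} \setminus S_2$ such that all four terms in this inequality are finite. *)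

theory Defs
  imports
    "HOL-Analysis.Analysis"
    "Jordan_Normal_Form.Char_Poly"
    "Jordan_Normal_Form.Gauss_Jordan_Elimination"
    "Jordan_Normal_Form.DL_Submatrix"
begin

text \<open>
  Matrices are those of Jordan_Normal_Form, because the number of columns of the input matrix
  varies (and may be \<open>0\<close>); their entries are indexed from \<open>0\<close>.
\<close>

definition strictly_stable :: "real mat \<Rightarrow> bool" where
  "strictly_stable A \<longleftrightarrow> square_mat A \<and>
     (\<forall>k. eigenvalue (map_mat complex_of_real A) k \<longrightarrow> Re k < 0)"

text \<open>
  There is no topology on the type of matrices, so the exponential series and the Gramian integral
  are taken entrywise.
\<close>

definition mat_exp :: "real mat \<Rightarrow> real mat" where
  "mat_exp A = Matrix.mat (dim_row A) (dim_row A)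
     (\<lambda>(i, j). \<Sum>k. (A ^\<^sub>m k) $$ (i, j) / fact k)"

definition mat_trace :: "'a::comm_monoid_add mat \<Rightarrow> 'a" where
  "mat_trace A = (\<Sum>i<dim_row A. A $$ (i, i))"

definition gramian :: "real mat \<Rightarrow> real mat \<Rightarrow> real mat" where
  "gramian A B = Matrix.mat (dim_row A) (dim_row A)
     (\<lambda>(i, j). integral {0..}
        (\<lambda>t::real. (mat_exp (t \<cdot>\<^sub>m A) * B * transpose_mat B * mat_exp (t \<cdot>\<^sub>m transpose_mat A)) $$ (i, j)))"

definition avg_energy :: "real mat \<Rightarrow> real mat \<Rightarrow> ereal" where
  "avg_energy A B =
     (if invertible_mat (gramian A B)
      then ereal (1 / real (dim_row A) * mat_trace (the (mat_inverse (gramian A B))))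
      else \<infinity>)"

text \<open>
  Column indices are numbered from \<open>1\<close> here, hence the shift to the \<open>0\<close>-based
  index set expected by \<^const>\<open>submatrix\<close>; the columns keep their increasing order.
\<close>

definition identity_columns :: "nat \<Rightarrow> nat set \<Rightarrow> real mat" where
  "identity_columns n S = submatrix (1\<^sub>m n) UNIV {j. Suc j \<in> S}"

text \<open>
  A set function on the subsets of \<open>{1..m}\<close> with values in the reals extended by \<open>+\<infinity>\<close>;
  its values on other sets are irrelevant.
\<close>

definition supermodular :: "nat \<Rightarrow> (nat set \<Rightarrow> ereal) \<Rightarrow> bool" where
  "supermodular m f \<longleftrightarrow>
     (\<forall>S1 S2 a. S1 \<subseteq> S2 \<longrightarrow> S2 \<subseteq> {1..m} \<longrightarrow> a \<in> {1..m} - S2 \<longrightarrow>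
        \<bar>f S1\<bar> \<noteq> \<infinity> \<longrightarrow> \<bar>f (insert a S1)\<bar> \<noteq> \<infinity> \<longrightarrow>
        \<bar>f S2\<bar> \<noteq> \<infinity> \<longrightarrow> \<bar>f (insert a S2)\<bar> \<noteq> \<infinity> \<longrightarrow>
        f S1 - f (insert a S1) \<ge> f S2 - f (insert a S2))"

lemma identity_columns_carrier:
  assumes "S \<subseteq> {1..n}"
  shows "identity_columns n S \<in> carrier_mat n (card S)"
proof -
  have "bij_betw Suc {j. j < n \<and> Suc j \<in> S} S"
    using assms by (auto simp: bij_betw_def image_iff) (metis Suc_le_eq Suc_pred atLeastAtMost_iff not0_implies_Suc not_one_le_zero subsetD)
  then have "card {j. j < n \<and> Suc j \<in> S} = card S"
    by (rule bij_betw_same_card)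
  then show ?thesis
    by (intro carrier_matI) (simp_all add: identity_columns_def dim_submatrix)
qed

end

theory Submission
  imports Defs
begin

text \<open>
  The matrix is \<open>A = - 2 (I - P) - 3 P\<close> for an orthogonal projection \<open>P\<close> of rank three on
  \<open>\<real>\<^sup>6\<close> with rational entries.  It has only the eigenvalues \<open>-2\<close> and \<open>-3\<close>, each of multiplicity
  three, so three actuated nodes are just enough to control the system.  The violation occurs at
  \<open>S1 = {1, 2, 3}\<close>, \<open>S2 = {1, 2, 3, 4}\<close> and the new node \<open>5\<close>: the trace of the inverse Gramian is
  \<open>3650\<close> for \<open>{1, 2, 3}\<close>, \<open>2350\<close> for both \<open>{1, 2, 3, 4}\<close> and \<open>{1, 2, 3, 5}\<close>, and \<open>1040\<close> for
  \<open>{1, 2, 3, 4, 5}\<close>.  Node \<open>5\<close> thus saves \<open>1300\<close> next to three actuators, but \<open>1310\<close> once node \<open>4\<close>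
  is actuated as well.

  The mechanism is that the trace of the inverse is not supermodular under the addition of
  positive semidefinite matrices that do not commute.  Let \<open>H\<close> be the inverse Gramian of
  \<open>{1, 2, 3}\<close>, and idealise an actuator at node \<open>u\<close> as one that moves the coordinate \<open>u\<close> for free.
  The trace then drops by \<open>(H\<^sup>2)\<^sub>u\<^sub>u / H\<^sub>u\<^sub>u\<close>, and for two such nodes by the trace of \<open>G\<^sup>-\<^sup>1 K\<close>, where
  \<open>G\<close> and \<open>K\<close> are the blocks of \<open>H\<close> and \<open>H\<^sup>2\<close> on the two coordinates.  If the off-diagonal entries
  of \<open>G\<close> and \<open>K\<close> have opposite signs, the joint drop exceeds the sum of the individual ones.  This
  is the case for the nodes \<open>4\<close> and \<open>5\<close>, where \<open>H\<close> has the entry \<open>25\<close>: both nodes are strongly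
  coupled to node \<open>6\<close>, the most expensive one, and with opposite signs, which makes the entry of
  \<open>H\<^sup>2\<close> negative.

  The Gramian is available in closed form because \<open>a (I - P) + b P\<close> is a functional calculus: it
  is multiplicative in \<open>(a, b)\<close>, hence \<open>exp (t A)\<close> is again such a combination, and the
  Gramian integral splits into integrals of three exponentials (\<open>gramian_spectral_comb\<close>).  What
  remains is rational arithmetic.  Each of the four traces is certified by an explicit inverse of
  the Gramian (\<open>avg_energy_dynamics\<close>).
\<close>

section \<open>Functional calculus of a projection\<close>

text \<open>
  For idempotent \<open>P\<close> this is the matrix that acts as \<open>a\<close> on the kernel of \<open>P\<close> and as \<open>b\<close> on its
  range.
\<close>

definition spectral_comb :: "'a::comm_ring_1 mat \<Rightarrow> 'a \<Rightarrow> 'a \<Rightarrow> 'a mat" where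
  "spectral_comb P a b = a \<cdot>\<^sub>m (1\<^sub>m (dim_row P) - P) + b \<cdot>\<^sub>m P"

lemma spectral_comb_carrier [simp]:
  "P \<in> carrier_mat n n \<Longrightarrow> spectral_comb P a b \<in> carrier_mat n n"
  by (auto simp: spectral_comb_def)

lemma spectral_comb_index:
  assumes "P \<in> carrier_mat n n" "i < n" "j < n"
  shows "spectral_comb P a b $$ (i, j) = a * ((1\<^sub>m n - P) $$ (i, j)) + b * (P $$ (i, j))"
  using assms by (auto simp: spectral_comb_def)

lemma complement_mult:
  fixes P :: "'a::comm_ring_1 mat"
  assumes P: "P \<in> carrier_mat n n" and idem: "P * P = P"
  shows "(1\<^sub>m n - P) * P = 0\<^sub>m n n" "P * (1\<^sub>m n - P) = 0\<^sub>m n n"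
    "(1\<^sub>m n - P) * (1\<^sub>m n - P) = 1\<^sub>m n - P"
proof -
  show a: "(1\<^sub>m n - P) * P = 0\<^sub>m n n"
    using P idem by (simp add: minus_mult_distrib_mat[of _ n n])
  show "P * (1\<^sub>m n - P) = 0\<^sub>m n n"
    using P idem by (simp add: mult_minus_distrib_mat[of _ n n _ n])
  have "(1\<^sub>m n - P) * (1\<^sub>m n - P) = (1\<^sub>m n - P) - (1\<^sub>m n - P) * P"
    using P by (subst mult_minus_distrib_mat[of _ n n _ n]) (auto intro!: minus_carrier_mat)
  also have "\<dots> = 1\<^sub>m n - P" unfolding a using P by (intro eq_matI) auto
  finally show "(1\<^sub>m n - P) * (1\<^sub>m n - P) = 1\<^sub>m n - P" .
qed

text \<open>
  The mixed products vanish because \<open>P\<close> and \<open>I - P\<close> are complementary idempotents, so the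
  coefficients on kernel and range multiply independently.
\<close>

lemma spectral_comb_mult:
  fixes P :: "'a::comm_ring_1 mat"
  assumes P: "P \<in> carrier_mat n n" and idem: "P * P = P"
  shows "spectral_comb P a b * spectral_comb P c d = spectral_comb P (a * c) (b * d)"
proof -
  define Q where "Q = 1\<^sub>m n - P"
  have Q: "Q \<in> carrier_mat n n" unfolding Q_def using P by (rule minus_carrier_mat)
  note prods = complement_mult[OF P idem, folded Q_def]
  have "(a \<cdot>\<^sub>m Q + b \<cdot>\<^sub>m P) * (c \<cdot>\<^sub>m Q + d \<cdot>\<^sub>m P)
      = (a \<cdot>\<^sub>m Q + b \<cdot>\<^sub>m P) * (c \<cdot>\<^sub>m Q) + (a \<cdot>\<^sub>m Q + b \<cdot>\<^sub>m P) * (d \<cdot>\<^sub>m P)"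
    using P Q by (intro mult_add_distrib_mat[of _ n n _ n]) simp_all
  also have "\<dots> = ((a \<cdot>\<^sub>m Q) * (c \<cdot>\<^sub>m Q) + (b \<cdot>\<^sub>m P) * (c \<cdot>\<^sub>m Q))
      + ((a \<cdot>\<^sub>m Q) * (d \<cdot>\<^sub>m P) + (b \<cdot>\<^sub>m P) * (d \<cdot>\<^sub>m P))"
    using P Q by (intro arg_cong2[of _ _ _ _ "(+)"] add_mult_distrib_mat[of _ n n _ _ n]) simp_all
  also have "\<dots> = (a * c) \<cdot>\<^sub>m Q + (b * d) \<cdot>\<^sub>m P"
    using P Q by (intro eq_matI)
      (auto simp: mult_smult_assoc_mat[of _ n n] mult_smult_distrib[of _ n n] prods idem ac_simps)
  finally show ?thesis using P by (simp add: spectral_comb_def Q_def)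
qed

lemma spectral_comb_one:
  "P \<in> carrier_mat n n \<Longrightarrow> spectral_comb P 1 1 = 1\<^sub>m n"
  by (intro eq_matI) (auto simp: spectral_comb_def)

lemma spectral_comb_pow:
  fixes P :: "'a::comm_ring_1 mat"
  assumes P: "P \<in> carrier_mat n n" and idem: "P * P = P"
  shows "spectral_comb P a b ^\<^sub>m k = spectral_comb P (a ^ k) (b ^ k)"
proof (induction k)
  case 0
  then show ?case using P by (simp add: spectral_comb_one spectral_comb_def[of P a b])
next
  case (Suc k)
  then show ?case by (simp add: spectral_comb_mult[OF P idem] mult.commute)
qed

lemma smult_spectral_comb:
  "P \<in> carrier_mat n n \<Longrightarrow> t \<cdot>\<^sub>m spectral_comb P a b = spectral_comb P (t * a) (t * b)"
  by (intro eq_matI) (auto simp: spectral_comb_def algebra_simps)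

lemma transpose_spectral_comb:
  assumes "P \<in> carrier_mat n n" "transpose_mat P = P"
  shows "transpose_mat (spectral_comb P a b) = spectral_comb P a b"
proof -
  have "P $$ (i, j) = P $$ (j, i)" if "i < n" "j < n" for i j
    using assms that by (metis carrier_matD index_transpose_mat(1))
  then show ?thesis using assms(1) by (intro eq_matI) (auto simp: spectral_comb_def)
qed

lemma mat_exp_spectral_comb:
  assumes P: "P \<in> carrier_mat n n" and idem: "P * P = P"
  shows "mat_exp (spectral_comb P a b) = spectral_comb P (exp a) (exp b)"
proof (rule eq_matI)
  fix i j assume "i < dim_row (spectral_comb P (exp a) (exp b))"
    and "j < dim_col (spectral_comb P (exp a) (exp b))"
  then have ij: "i < n" "j < n" using P by (auto simp: spectral_comb_def)
  define q p where "q = (1\<^sub>m n - P) $$ (i, j)" and "p = P $$ (i, j)"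
  have "(\<lambda>k. (a ^ k /\<^sub>R fact k) * q + (b ^ k /\<^sub>R fact k) * p) sums (exp a * q + exp b * p)"
    by (intro sums_add sums_mult2 exp_converges)
  also have "(\<lambda>k. (a ^ k /\<^sub>R fact k) * q + (b ^ k /\<^sub>R fact k) * p)
      = (\<lambda>k. (spectral_comb P a b ^\<^sub>m k) $$ (i, j) / fact k)"
    using P ij by (intro ext)
      (simp add: spectral_comb_pow[OF P idem] spectral_comb_index q_def p_def field_simps)
  finally have "(\<Sum>k. (spectral_comb P a b ^\<^sub>m k) $$ (i, j) / fact k) = exp a * q + exp b * p"
    by (rule sums_unique[symmetric])
  then show "mat_exp (spectral_comb P a b) $$ (i, j) = spectral_comb P (exp a) (exp b) $$ (i, j)"
    using P ij carrier_matD[OF spectral_comb_carrier[OF P, of a b]]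
    by (simp add: mat_exp_def spectral_comb_index q_def p_def)
qed (use P in \<open>auto simp: mat_exp_def spectral_comb_def\<close>)

text \<open>
  Any other \<open>k\<close> would make \<open>a - k\<close> and \<open>b - k\<close> invertible, and inverting them in the functional
  calculus inverts \<open>a (I - P) + b P - k I\<close>.
\<close>

lemma eigenvalue_spectral_comb:
  fixes P :: "'a::field mat"
  assumes P: "P \<in> carrier_mat n n" and idem: "P * P = P"
    and ev: "eigenvalue (spectral_comb P a b) k"
  shows "k = a \<or> k = b"
proof (rule ccontr)
  assume "\<not> (k = a \<or> k = b)"
  let ?R = "spectral_comb P (1 / (a - k)) (1 / (b - k))"
  from ev obtain v where v: "v \<in> carrier_vec n" "v \<noteq> 0\<^sub>v n"
    and eq: "spectral_comb P a b *\<^sub>v v = k \<cdot>\<^sub>v v"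
    using P by (auto simp: eigenvalue_def eigenvector_def spectral_comb_def)
  have "spectral_comb P (a - k) (b - k) = spectral_comb P a b - k \<cdot>\<^sub>m 1\<^sub>m n"
    using P by (intro eq_matI) (auto simp: spectral_comb_def algebra_simps)
  moreover have "k \<cdot>\<^sub>m 1\<^sub>m n *\<^sub>v v = k \<cdot>\<^sub>v v"
    using v(1) by (intro eq_vecI) auto
  ultimately have "spectral_comb P (a - k) (b - k) *\<^sub>v v = spectral_comb P a b *\<^sub>v v - k \<cdot>\<^sub>v v"
    using P v(1) by (simp add: minus_mult_distrib_mat_vec[of _ n n])
  then have zero: "spectral_comb P (a - k) (b - k) *\<^sub>v v = 0\<^sub>v n"
    using v(1) by (simp add: eq)
  have "?R * spectral_comb P (a - k) (b - k) = 1\<^sub>m n"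
    using \<open>\<not> (k = a \<or> k = b)\<close> P by (auto simp: spectral_comb_mult[OF P idem] spectral_comb_one)
  then have "v = (?R * spectral_comb P (a - k) (b - k)) *\<^sub>v v" using v by simp
  also have "\<dots> = ?R *\<^sub>v 0\<^sub>v n"
    using P v(1) zero by (subst assoc_mult_mat_vec[of _ n n _ n]) auto
  also have "\<dots> = 0\<^sub>v n" using carrier_matD[OF spectral_comb_carrier[OF P]]
    by (intro eq_vecI) (auto simp: scalar_prod_def)
  finally show False using v(2) by simp
qed

lemma strictly_stable_spectral_comb:
  fixes P :: "real mat"
  assumes P: "P \<in> carrier_mat n n" and idem: "P * P = P" and "a < 0" "b < 0"
  shows "strictly_stable (spectral_comb P a b)"
proof -
  let ?c = "map_mat complex_of_real"
  have Pc: "?c P \<in> carrier_mat n n" using P by simp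
  have "?c P * ?c P = ?c P"
    using idem of_real_hom.mat_hom_mult[OF P P] by metis
  moreover have "?c (spectral_comb P a b) = spectral_comb (?c P) (complex_of_real a) (complex_of_real b)"
    using P by (intro eq_matI) (auto simp: spectral_comb_def)
  ultimately have "k = complex_of_real a \<or> k = complex_of_real b"
    if "eigenvalue (?c (spectral_comb P a b)) k" for k
    using eigenvalue_spectral_comb[OF Pc] that by metis
  then have "Re k < 0" if "eigenvalue (?c (spectral_comb P a b)) k" for k
    using that assms(3,4) by fastforce
  moreover have "square_mat (spectral_comb P a b)" using P by (simp add: spectral_comb_def)
  ultimately show ?thesis by (simp add: strictly_stable_def)
qed

section \<open>The Gramian in closed form\<close>

lemma has_integral_exp_Ici:
  fixes c :: real
  assumes "c > 0"
  shows "((\<lambda>t. exp (- c * t)) has_integral 1 / c) {0..}"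
  using has_integral_exp_minus_to_infinity[OF assms, of 0] by simp

text \<open>
  An entry of the Gramian integrand is a sum of such products, one for each actuator: every
  entry of \<open>exp (t A)\<close> has a part decaying at rate \<open>a\<close> and a part decaying at rate \<open>b\<close>.
\<close>

lemma has_integral_two_rates:
  fixes a b :: real
  assumes "a > 0" "b > 0"
  shows "((\<lambda>t. (exp (t * - a) * p + exp (t * - b) * q) * (exp (t * - a) * r + exp (t * - b) * s))
    has_integral p * r / (2 * a) + (p * s + q * r) / (a + b) + q * s / (2 * b)) {0..}"
proof -
  have "((\<lambda>t. exp (- (2 * a) * t) * (p * r) + exp (- (a + b) * t) * (p * s + q * r)
        + exp (- (2 * b) * t) * (q * s))
      has_integral 1 / (2 * a) * (p * r) + 1 / (a + b) * (p * s + q * r) + 1 / (2 * b) * (q * s)) {0..}"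
    using assms by (intro has_integral_add has_integral_mult_left has_integral_exp_Ici) auto
  moreover have "exp (- (2 * a) * t) * (p * r) + exp (- (a + b) * t) * (p * s + q * r)
        + exp (- (2 * b) * t) * (q * s)
      = (exp (t * - a) * p + exp (t * - b) * q) * (exp (t * - a) * r + exp (t * - b) * s)" for t
  proof -
    have "exp (- (2 * a) * t) = exp (t * - a) * exp (t * - a)"
      "exp (- (a + b) * t) = exp (t * - a) * exp (t * - b)"
      "exp (- (2 * b) * t) = exp (t * - b) * exp (t * - b)"
      by (simp_all add: algebra_simps flip: exp_add)
    then show ?thesis by (simp add: algebra_simps)
  qed
  ultimately show ?thesis by simp
qed

text \<open>
  Multiplication by the selected columns of the identity selects columns; \<open>pick\<close> enumerates the
  selected indices in increasing order.
\<close>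

lemma mult_identity_columns_index:
  fixes M :: "real mat"
  assumes M: "M \<in> carrier_mat m n" and i: "i < m" and c: "c < dim_col (identity_columns n S)"
  shows "pick {j. Suc j \<in> S} c < n"
    and "(M * identity_columns n S) $$ (i, c) = M $$ (i, pick {j. Suc j \<in> S} c)"
proof -
  let ?J = "{j. Suc j \<in> S}"
  have c': "c < card {j. j < n \<and> j \<in> ?J}" using c by (simp add: identity_columns_def dim_submatrix)
  show p: "pick ?J c < n" using pick_le[OF c'] .
  have dr: "dim_row (identity_columns n S) = n" by (simp add: identity_columns_def dim_submatrix)
  have "identity_columns n S $$ (k, c) = (if k = pick ?J c then 1 else 0)" if "k < n" for k
    using that c' p by (simp add: identity_columns_def submatrix_index pick_UNIV)
  then have "(M * identity_columns n S) $$ (i, c)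
      = (\<Sum>k = 0..<n. M $$ (i, k) * (if k = pick ?J c then 1 else 0))"
    using M i c dr by (auto simp: scalar_prod_def intro!: sum.cong)
  also have "\<dots> = M $$ (i, pick ?J c)" using p by (simp add: if_distrib cong: if_cong)
  finally show "(M * identity_columns n S) $$ (i, c) = M $$ (i, pick ?J c)" .
qed

lemma bij_betw_pick_identity_columns:
  "bij_betw (pick {j. Suc j \<in> S}) {..<dim_col (identity_columns n S)} {j. j < n \<and> Suc j \<in> S}"
proof -
  let ?J = "{j. Suc j \<in> S}"
  have dc: "dim_col (identity_columns n S) = card {j. j < n \<and> j \<in> ?J}"
    by (simp add: identity_columns_def dim_submatrix)
  let ?I = "{j. j < n \<and> j \<in> ?J}"
  have pick: "pick ?J c = pick ?I c" if "c < card ?I" for c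
    using pick_reduce_set[OF that] .
  have "inj_on (pick ?J) {..<card ?I}"
  proof (rule inj_onI)
    fix c d assume "c \<in> {..<card ?I}" "d \<in> {..<card ?I}" and eq: "pick ?J c = pick ?J d"
    then have cd: "c < card ?I" "d < card ?I" by auto
    have "c = card {a \<in> ?I. a < pick ?I c}" using card_pick_le[OF cd(1)] by simp
    also have "\<dots> = card {a \<in> ?I. a < pick ?I d}" using eq pick cd by simp
    also have "\<dots> = d" using card_pick_le[OF cd(2)] by simp
    finally show "c = d" .
  qed
  moreover have "pick ?J ` {..<card ?I} \<subseteq> ?I"
    using pick pick_in_set_le[of _ ?I] by fastforce
  ultimately have "bij_betw (pick ?J) {..<card ?I} ?I"
    by (intro bij_betw_imageI card_subset_eq) (auto simp: card_image)
  then show ?thesis by (simp add: dc)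
qed

text \<open>
  In terms of the diagonal matrix \<open>E\<close> that indicates the actuated nodes, this is
  \<open>Q E Q / (2 a) + (Q E P + P E Q) / (a + b) + P E P / (2 b)\<close>, written as a sum over actuators
  because every actuator contributes additively.
\<close>

lemma gramian_spectral_comb:
  fixes P :: "real mat"
  assumes P: "P \<in> carrier_mat n n" and idem: "P * P = P" and sym: "transpose_mat P = P"
    and ab: "a > 0" "b > 0"
  defines "Q \<equiv> 1\<^sub>m n - P"
  shows "gramian (spectral_comb P (- a) (- b)) (identity_columns n S) = Matrix.mat n n (\<lambda>(i, j).
    \<Sum>s | s < n \<and> Suc s \<in> S. Q $$ (i, s) * Q $$ (j, s) / (2 * a)
      + (Q $$ (i, s) * P $$ (j, s) + P $$ (i, s) * Q $$ (j, s)) / (a + b)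
      + P $$ (i, s) * P $$ (j, s) / (2 * b))"
  (is "_ = Matrix.mat n n (\<lambda>(i, j). ?W i j)")
proof (rule eq_matI)
  let ?A = "spectral_comb P (- a) (- b)" and ?B = "identity_columns n S" and ?J = "{j. Suc j \<in> S}"
  have dimA: "dim_row ?A = n" using P by (simp add: spectral_comb_def)
  then show "dim_row (gramian ?A ?B) = dim_row (Matrix.mat n n (\<lambda>(i, j). ?W i j))"
    "dim_col (gramian ?A ?B) = dim_col (Matrix.mat n n (\<lambda>(i, j). ?W i j))"
    by (simp_all add: gramian_def)
  fix i j assume "i < dim_row (Matrix.mat n n (\<lambda>(i, j). ?W i j))"
    "j < dim_col (Matrix.mat n n (\<lambda>(i, j). ?W i j))"
  then have ij: "i < n" "j < n" by simp_all
  let ?E = "\<lambda>t. spectral_comb P (exp (t * - a)) (exp (t * - b))"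
  define k where "k = dim_col ?B"
  have B: "?B \<in> carrier_mat n k"
    by (rule carrier_matI) (simp_all add: k_def identity_columns_def dim_submatrix)
  have E: "?E t \<in> carrier_mat n n" for t using P by simp
  have EA: "mat_exp (t \<cdot>\<^sub>m ?A) = ?E t" "mat_exp (t \<cdot>\<^sub>m transpose_mat ?A) = transpose_mat (?E t)" for t
    using P by (simp_all add: transpose_spectral_comb[OF P sym] smult_spectral_comb
        mat_exp_spectral_comb[OF P idem])
  have "(?E t * ?B * transpose_mat ?B * transpose_mat (?E t)) $$ (i, j)
      = (\<Sum>s | s < n \<and> Suc s \<in> S. (exp (t * - a) * Q $$ (i, s) + exp (t * - b) * P $$ (i, s))
          * (exp (t * - a) * Q $$ (j, s) + exp (t * - b) * P $$ (j, s)))" for t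
  proof -
    \<comment> \<open>The integrand has the form \<open>M M'\<close> with \<open>M = exp (t A) B\<close>, whose columns are those of
      \<open>exp (t A)\<close> at the actuated nodes.\<close>
    have "?E t * ?B * transpose_mat ?B * transpose_mat (?E t) = (?E t * ?B) * transpose_mat (?E t * ?B)"
      unfolding transpose_mult[OF E B] using E[of t] B
      by (intro assoc_mult_mat[of _ n k _ n _ n]) simp_all
    also have "\<dots> $$ (i, j) = (\<Sum>c<k. (?E t * ?B) $$ (i, c) * (?E t * ?B) $$ (j, c))"
    proof -
      have "(M * transpose_mat M) $$ (i, j) = (\<Sum>c<k. M $$ (i, c) * M $$ (j, c))"
        if "M \<in> carrier_mat n k" for M :: "real mat"
        using that ij by (auto simp: scalar_prod_def lessThan_atLeast0)
      then show ?thesis using mult_carrier_mat[OF E B] .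
    qed
    also have "\<dots> = (\<Sum>c<k. ?E t $$ (i, pick ?J c) * ?E t $$ (j, pick ?J c))"
      using mult_identity_columns_index(2)[OF E ij(1)] mult_identity_columns_index(2)[OF E ij(2)]
      by (intro sum.cong refl arg_cong2[of _ _ _ _ "(*)"]) (simp_all only: k_def lessThan_iff)
    also have "\<dots> = (\<Sum>s | s < n \<and> Suc s \<in> S. ?E t $$ (i, s) * ?E t $$ (j, s))"
      unfolding k_def by (rule sum.reindex_bij_betw[OF bij_betw_pick_identity_columns])
    finally show ?thesis using ij P by (simp add: spectral_comb_index Q_def)
  qed
  then have "integral {0..} (\<lambda>t. (mat_exp (t \<cdot>\<^sub>m ?A) * ?B * transpose_mat ?B
        * mat_exp (t \<cdot>\<^sub>m transpose_mat ?A)) $$ (i, j)) = ?W i j"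
    unfolding EA using ab
    by (simp only:) (intro integral_unique has_integral_sum has_integral_two_rates, simp_all)
  then show "gramian ?A ?B $$ (i, j) = Matrix.mat n n (\<lambda>(i, j). ?W i j) $$ (i, j)"
    using ij by (simp add: gramian_def dimA)
qed

text \<open>
  A one-sided inverse of a square matrix determines the result of the elimination algorithm behind
  \<^const>\<open>mat_inverse\<close>, so that an inverse found by other means can be used.
\<close>

lemma avg_energy_eq:
  assumes G: "gramian A B * Y = 1\<^sub>m n" and A: "dim_row A = n" and Y: "Y \<in> carrier_mat n n"
  shows "avg_energy A B = ereal (mat_trace Y / real n)"
proof -
  let ?W = "gramian A B"
  have W: "?W \<in> carrier_mat n n" by (simp add: gramian_def A)
  have YW: "Y * ?W = 1\<^sub>m n" using mat_mult_left_right_inverse[OF W Y G] .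
  have inv: "invertible_mat ?W"
    using W Y G YW by (auto simp: invertible_mat_def inverts_mat_def intro!: exI[of _ Y])
  have "mat_inverse ?W = Some Y"
  proof (cases "mat_inverse ?W")
    case None
    then have "?W \<notin> Units (ring_mat TYPE(real) n ())" by (rule mat_inverse(1)[OF W])
    moreover have "?W \<in> Units (ring_mat TYPE(real) n ())"
      unfolding Units_def ring_mat_def using W Y G YW by auto
    ultimately show ?thesis by simp
  next
    case (Some Z)
    with mat_inverse(2)[OF W] have Z: "Z * ?W = 1\<^sub>m n" "Z \<in> carrier_mat n n" by auto
    have "Z = Z * (?W * Y)" using Z G by simp
    also have "\<dots> = (Z * ?W) * Y" using Z W Y by (intro assoc_mult_mat[symmetric])
    also have "\<dots> = Y" using Z Y by simp
    finally show ?thesis using Some by simp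
  qed
  then show ?thesis using inv A by (simp add: avg_energy_def)
qed

section \<open>The counterexample\<close>

text \<open>
  The projection has rank three; its range is spanned by \<open>(-1, 1, -1, -1, 1, 1)\<close>, \<open>(0, 0, 1, 1, 1, 1)\<close>
  and \<open>(1, 0, 0, -1, -1, 1)\<close>, and \<open>30\<close> is the common denominator of its entries.  The integer
  tables below clear this denominator, so that all checks are integer arithmetic.
\<close>

definition proj_num :: "int list list" where
  "proj_num = [[13, -5, 7, -1, -11, 5], [-5, 5, -5, -5, 5, 5], [7, -5, 13, 11, 1, 5],
     [-1, -5, 11, 17, 7, -5], [-11, 5, 1, 7, 17, 5], [5, 5, 5, -5, 5, 25]]"

definition proj :: "real mat" where
  "proj = Matrix.mat 6 6 (\<lambda>(i, j). real_of_int (proj_num ! i ! j) / 30)"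

text \<open>
  This is \<open>54000\<close> times the entry of the Gramian for the actuators \<open>ss\<close> (numbered from \<open>0\<close>).
  With the rates \<open>2\<close> and \<open>3\<close> and the diagonal matrix \<open>E\<close> that indicates the actuators, expanding
  \<open>Q = I - P\<close> in the closed form gives \<open>E / 4 - (E P + P E) / 20 + P E P / 60\<close>; every factor \<open>P\<close>
  contributes a denominator \<open>30\<close>.
\<close>

definition gram_num :: "nat list \<Rightarrow> nat \<Rightarrow> nat \<Rightarrow> int" where
  "gram_num ss i j = (\<Sum>s\<leftarrow>ss.
     (if i = s then (if j = s then 13500 else 0) - 90 * proj_num ! j ! s else 0)
     - (if j = s then 90 * proj_num ! i ! s else 0) + proj_num ! i ! s * proj_num ! j ! s)"

lemma upt_0_6: "[0..<6] = [0, 1, 2, 3, 4, 5]"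
  by (simp add: upt_rec)

lemma proj_num_idem:
  "\<forall>i\<in>set [0..<6]. \<forall>j\<in>set [0..<6].
     (\<Sum>k\<leftarrow>[0..<6]. proj_num ! i ! k * proj_num ! k ! j) = 30 * proj_num ! i ! j"
  by code_simp

lemma proj_num_sym:
  "\<forall>i\<in>set [0..<6]. \<forall>j\<in>set [0..<6]. proj_num ! i ! j = proj_num ! j ! i"
  by code_simp

lemma proj_carrier [simp]: "proj \<in> carrier_mat 6 6"
  by (simp add: proj_def)

lemma proj_idem: "proj * proj = proj"
proof (rule eq_matI)
  fix i j assume "i < dim_row proj" "j < dim_col proj"
  then have ij: "i < 6" "j < 6" by (simp_all add: proj_def)
  have "(\<Sum>k = 0..<6. proj_num ! i ! k * proj_num ! k ! j) = 30 * proj_num ! i ! j"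
    using proj_num_idem ij by (simp only: interv_sum_list_conv_sum_set_nat set_upt atLeastLessThan_iff) simp
  then have "real_of_int (\<Sum>k = 0..<6. proj_num ! i ! k * proj_num ! k ! j) = 30 * proj_num ! i ! j"
    by (simp only: of_int_mult of_int_numeral)
  then show "(proj * proj) $$ (i, j) = proj $$ (i, j)"
    using ij by (simp add: proj_def scalar_prod_def flip: sum_divide_distrib)
qed (simp_all add: proj_def)

lemma proj_sym: "transpose_mat proj = proj"
  using proj_num_sym by (intro eq_matI) (auto simp: proj_def)

definition dynamics :: "real mat" where
  "dynamics = spectral_comb proj (- 2) (- 3)"

lemma gramian_dynamics:
  assumes S: "{s. s < 6 \<and> Suc s \<in> S} = set ss" and ss: "distinct ss"
  shows "gramian dynamics (identity_columns 6 S)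
    = Matrix.mat 6 6 (\<lambda>(i, j). real_of_int (gram_num ss i j) / 54000)"
proof -
  have proj: "proj $$ (i, s) = real_of_int (proj_num ! i ! s) / 30" if "i < 6" "s < 6" for i s
    using that by (simp add: proj_def)
  have compl: "(1\<^sub>m 6 - proj) $$ (i, s) = (if i = s then 1 else 0) - real_of_int (proj_num ! i ! s) / 30"
    if "i < 6" "s < 6" for i s
    using that by (simp add: proj_def)
  have sub: "s < 6" if "s \<in> set ss" for s using S that by blast
  have "gramian dynamics (identity_columns 6 S) = Matrix.mat 6 6 (\<lambda>(i, j). \<Sum>s\<in>set ss.
      (1\<^sub>m 6 - proj) $$ (i, s) * (1\<^sub>m 6 - proj) $$ (j, s) / (2 * 2)
      + ((1\<^sub>m 6 - proj) $$ (i, s) * proj $$ (j, s) + proj $$ (i, s) * (1\<^sub>m 6 - proj) $$ (j, s)) / (2 + 3)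
      + proj $$ (i, s) * proj $$ (j, s) / (2 * 3))"
    unfolding dynamics_def S[symmetric]
    by (rule gramian_spectral_comb[OF proj_carrier proj_idem proj_sym]) simp_all
  also have "\<dots> = Matrix.mat 6 6 (\<lambda>(i, j). real_of_int (gram_num ss i j) / 54000)"
  proof (rule eq_matI, goal_cases)
    case (1 i j)
    then have ij: "i < 6" "j < 6" by simp_all
    have "(\<Sum>s\<in>set ss. (1\<^sub>m 6 - proj) $$ (i, s) * (1\<^sub>m 6 - proj) $$ (j, s) / (2 * 2)
        + ((1\<^sub>m 6 - proj) $$ (i, s) * proj $$ (j, s) + proj $$ (i, s) * (1\<^sub>m 6 - proj) $$ (j, s)) / (2 + 3)
        + proj $$ (i, s) * proj $$ (j, s) / (2 * 3))
      = (\<Sum>s\<in>set ss. real_of_int (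
        (if i = s then (if j = s then 13500 else 0) - 90 * proj_num ! j ! s else 0)
        - (if j = s then 90 * proj_num ! i ! s else 0) + proj_num ! i ! s * proj_num ! j ! s) / 54000)"
      by (intro sum.cong refl) (simp only: ij sub proj compl, simp add: field_simps)
    also have "\<dots> = real_of_int (gram_num ss i j) / 54000"
      unfolding gram_num_def sum_list_distinct_conv_sum_set[OF ss] of_int_sum sum_divide_distrib ..
    finally show ?case using ij by simp
  qed simp_all
  finally show ?thesis .
qed

text \<open>
  The row \<open>r\<close> is a separate argument so that evaluation computes a row of the Gramian once
  and not again for every column of \<open>Z\<close>.
\<close>

definition inverse_row :: "int list list \<Rightarrow> int \<Rightarrow> nat \<Rightarrow> int list \<Rightarrow> bool" where
  "inverse_row Z d i r \<longleftrightarrow> (\<forall>j\<in>set [0..<6].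
     (\<Sum>k\<leftarrow>[0..<6]. r ! k * Z ! k ! j) = (if i = j then 54000 * d else 0))"

text \<open>
  The integer matrix \<open>Z\<close> divided by \<open>d\<close> is the inverse of the Gramian; multiplying by \<open>54000 * d\<close>
  turns the defining equation of the inverse into an identity between integers.
\<close>

lemma avg_energy_dynamics:
  assumes S: "{s. s < 6 \<and> Suc s \<in> S} = set ss" and ss: "distinct ss" and d: "d \<noteq> 0"
    and cert: "\<forall>i\<in>set [0..<6]. inverse_row Z d i (map (gram_num ss i) [0..<6])"
  shows "avg_energy dynamics (identity_columns 6 S)
    = ereal (real_of_int (\<Sum>k\<leftarrow>[0..<6]. Z ! k ! k) / (6 * real_of_int d))"
proof -
  let ?Y = "Matrix.mat 6 6 (\<lambda>(i, j). real_of_int (Z ! i ! j) / real_of_int d)"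
  have "gramian dynamics (identity_columns 6 S) * ?Y = 1\<^sub>m 6"
  proof (rule eq_matI)
    fix i j assume "i < dim_row (1\<^sub>m 6 :: real mat)" "j < dim_col (1\<^sub>m 6 :: real mat)"
    then have ij: "i < 6" "j < 6" by simp_all
    have "(\<Sum>k = 0..<6. map (gram_num ss i) [0..<6] ! k * Z ! k ! j) = (if i = j then 54000 * d else 0)"
      using cert ij
      by (simp only: inverse_row_def interv_sum_list_conv_sum_set_nat set_upt atLeastLessThan_iff) simp
    then have "(\<Sum>k = 0..<6. gram_num ss i k * Z ! k ! j) = (if i = j then 54000 * d else 0)"
      by simp
    then have "real_of_int (\<Sum>k = 0..<6. gram_num ss i k * Z ! k ! j)
        = (if i = j then 54000 * real_of_int d else 0)"
      by (simp del: of_int_sum)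
    then show "(gramian dynamics (identity_columns 6 S) * ?Y) $$ (i, j) = 1\<^sub>m 6 $$ (i, j)"
      using ij d by (simp add: gramian_dynamics[OF S ss] scalar_prod_def flip: sum_divide_distrib)
  qed (simp_all add: gramian_dynamics[OF S ss])
  then have "avg_energy dynamics (identity_columns 6 S) = ereal (mat_trace ?Y / real 6)"
    by (rule avg_energy_eq) (simp_all add: dynamics_def spectral_comb_def proj_def)
  also have "mat_trace ?Y = real_of_int (\<Sum>k\<leftarrow>[0..<6]. Z ! k ! k) / real_of_int d"
    unfolding interv_sum_list_conv_sum_set_nat
    by (simp add: mat_trace_def lessThan_atLeast0 sum_divide_distrib)
  finally show ?thesis by simp
qed

lemma avg_energy_values:
  shows "avg_energy dynamics (identity_columns 6 {1, 2, 3}) = ereal (3650 / 6)"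
    and "avg_energy dynamics (identity_columns 6 {1, 2, 3, 4}) = ereal (2350 / 6)"
    and "avg_energy dynamics (identity_columns 6 {1, 2, 3, 5}) = ereal (2350 / 6)"
    and "avg_energy dynamics (identity_columns 6 {1, 2, 3, 4, 5}) = ereal (1040 / 6)"
proof -
  \<comment> \<open>Rows \<open>4\<close> and \<open>5\<close> of this table show the interference: their common entry is \<open>25\<close>, but they
    couple to node \<open>6\<close> with \<open>-375\<close> and \<open>375\<close>, so that their inner product is negative.\<close>
  have inverse: "\<forall>i\<in>set [0..<6]. inverse_row
       [[10, 0, 0, -20, -50, 40],
        [0, 10, 0, -40, 40, 90],
        [0, 0, 10, 50, 20, 40],
        [-20, -40, 50, 840, 25, -375],
        [-50, 40, 20, 25, 840, 375],
        [40, 90, 40, -375, 375, 1940]]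
       1 i (map (gram_num [0, 1, 2] i) [0..<6])"
    by code_simp
  show "avg_energy dynamics (identity_columns 6 {1, 2, 3}) = ereal (3650 / 6)"
    by (subst avg_energy_dynamics[OF _ _ _ inverse]) (auto simp: upt_0_6)
next
  have inverse: "\<forall>i\<in>set [0..<6]. inverse_row
       [[81, -11, 7, -23, -375, 145],
        [-11, 81, 23, -7, 425, 705],
        [7, 23, 69, -1, 225, 565],
        [-23, -7, -1, 69, 175, -285],
        [-375, 425, 225, 175, 7400, 5250],
        [145, 705, 565, -285, 5250, 15800]]
       10 i (map (gram_num [0, 1, 2, 3] i) [0..<6])"
    by code_simp
  show "avg_energy dynamics (identity_columns 6 {1, 2, 3, 4}) = ereal (2350 / 6)"
    by (subst avg_energy_dynamics[OF _ _ _ inverse]) (auto simp: upt_0_6)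
next
  have inverse: "\<forall>i\<in>set [0..<6]. inverse_row
       [[69, 23, 7, -225, 1, 565],
        [23, 81, -11, -425, 7, 705],
        [7, -11, 81, 375, 23, 145],
        [-225, -425, 375, 7400, 175, -5250],
        [1, 7, 23, 175, 69, 285],
        [565, 705, 145, -5250, 285, 15800]]
       10 i (map (gram_num [0, 1, 2, 4] i) [0..<6])"
    by code_simp
  show "avg_energy dynamics (identity_columns 6 {1, 2, 3, 5}) = ereal (2350 / 6)"
    by (subst avg_energy_dynamics[OF _ _ _ inverse]) (auto simp: upt_0_6)
next
  have inverse: "\<forall>i\<in>set [0..<6]. inverse_row
       [[90, 12, 24, -18, 6, 510],
        [12, 82, 12, -22, 22, 510],
        [24, 12, 90, -6, 18, 510],
        [-18, -22, -6, 94, -10, -510],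
        [6, 22, 18, -10, 94, 510],
        [510, 510, 510, -510, 510, 15150]]
       15 i (map (gram_num [0, 1, 2, 3, 4] i) [0..<6])"
    by code_simp
  show "avg_energy dynamics (identity_columns 6 {1, 2, 3, 4, 5}) = ereal (1040 / 6)"
    by (subst avg_energy_dynamics[OF _ _ _ inverse]) (auto simp: upt_0_6)
qed

theorem theorem2:
  shows "\<exists>A :: real mat. A \<in> carrier_mat 6 6 \<and> strictly_stable A \<and> transpose_mat A = A \<and>
           \<not> supermodular 6 (\<lambda>S. avg_energy A (identity_columns 6 S))"
proof (intro exI conjI)
  show "dynamics \<in> carrier_mat 6 6" by (simp add: dynamics_def)
  show "strictly_stable dynamics"
    unfolding dynamics_def by (rule strictly_stable_spectral_comb[OF proj_carrier proj_idem]) simp_all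
  show "transpose_mat dynamics = dynamics"
    unfolding dynamics_def by (rule transpose_spectral_comb[OF proj_carrier proj_sym])
  let ?f = "\<lambda>S. avg_energy dynamics (identity_columns 6 S)"
  have insert5: "insert 5 {1, 2, 3} = {1, 2, 3, 5::nat}" "insert 5 {1, 2, 3, 4} = {1, 2, 3, 4, 5::nat}"
    by auto
  show "\<not> supermodular 6 ?f"
  proof
    assume "supermodular 6 ?f"
    from this[unfolded supermodular_def, rule_format, of "{1, 2, 3}" "{1, 2, 3, 4}" 5]
    show False
      unfolding insert5 avg_energy_values by simp
  qed
qed

end
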